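(* Let $\mathscr C$ be a braided monoidal category. The functor $\otimes:\mathscr C\times\mathscr C\to\mathscr C$ is a strong monoidal functor, with the monoidal structure $$(X_1\otimes Y_1)\otimes(X_2\otimes Y_2)\to(X_1\otimes X_2)\otimes(Y_1\otimes Y_2)\qquad(X_1,X_2,Y_1,Y_2\in\mathscr C)$$ given by the parenthesized braid in which the strands of $X_1$ and $Y_2$ are straight and the strand of $Y_1$, moving to the right, crosses over the strand of $X_2$, moving to the left; i.e. the composite of associativity constraints with the braiding $c_{Y_1,X_2}:Y_1\otimes X_2\to X_2\otimes Y_1$ applied to the two middle factors.
   Context: $\mathscr C\times\mathscr C$ has the componentwise monoidal structure $(X_1,Y_1)\otimes(X_2,Y_2)=(X_1\otimes X_2,Y_1\otimes Y_2)$. A strong monoidal structure on a functor $F$ between monoidal categories is a natural isomorphism between $F(X)\otimes F(Y)$ and $F(X\otimes Y)$ such that the two composites relating $F((X\otimes Y)\otimes Z)$ and $F(X)\otimes(F(Y)\otimes F(Z))$ (using the associativity constraint of the source before, respectively that of the target after, splitting into factors) coincide; the unit coherence isomorphism for $\otimes$ is the canonical $1\otimes1\cong1$. Explicitly the monoidal structure map is $$(X_1 Y_1)(X_2Y_2)\to X_1((Y_1X_2)Y_2)\xrightarrow{1\otimes(c_{Y_1,X_2}\otimes1)}X_1((X_2Y_1)Y_2)\to(X_1X_2)(Y_1Y_2),$$ where the unmarked arrows are the (unique by coherence) composites of associativity constraints and $\otimes$ signs are omitted. *)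

theory Defs
  imports Main
begin

section \<open>Categories, functors and natural isomorphisms\<close>

text \<open>
  Objects and arrows form carrier sets inside two types. All axioms are relativised to the
  carriers, and composition of non-composable arrows is unspecified.
\<close>

record ('o, 'm) cat_data =
  Obj :: "'o set"
  Arr :: "'m set"
  Dom :: "'m \<Rightarrow> 'o"
  Cod :: "'m \<Rightarrow> 'o"
  Ident :: "'o \<Rightarrow> 'm"
  Comp :: "'m \<Rightarrow> 'm \<Rightarrow> 'm"  (infixr \<open>\<cdot>\<index>\<close> 65)

definition hom :: "('o, 'm, 'z) cat_data_scheme \<Rightarrow> 'o \<Rightarrow> 'o \<Rightarrow> 'm set" where
  "hom C X Y = {f \<in> Arr C. Dom C f = X \<and> Cod C f = Y}"

locale category =
  fixes C :: "('o, 'm, 'z) cat_data_scheme" (structure)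
  assumes Dom_Obj: "f \<in> Arr C \<Longrightarrow> Dom C f \<in> Obj C"
    and Cod_Obj: "f \<in> Arr C \<Longrightarrow> Cod C f \<in> Obj C"
    and Id_hom: "X \<in> Obj C \<Longrightarrow> Ident C X \<in> hom C X X"
    and Comp_hom: "f \<in> hom C X Y \<Longrightarrow> g \<in> hom C Y Z \<Longrightarrow> g \<cdot> f \<in> hom C X Z"
    and Comp_Id_left: "f \<in> hom C X Y \<Longrightarrow> Ident C Y \<cdot> f = f"
    and Comp_Id_right: "f \<in> hom C X Y \<Longrightarrow> f \<cdot> Ident C X = f"
    and Comp_assoc: "f \<in> hom C W X \<Longrightarrow> g \<in> hom C X Y \<Longrightarrow> h \<in> hom C Y Z \<Longrightarrow>
      (h \<cdot> g) \<cdot> f = h \<cdot> (g \<cdot> f)"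

definition inverse_arrows :: "('o, 'm, 'z) cat_data_scheme \<Rightarrow> 'm \<Rightarrow> 'm \<Rightarrow> bool" where
  "inverse_arrows C f g \<longleftrightarrow>
     f \<in> Arr C \<and> g \<in> hom C (Cod C f) (Dom C f) \<and>
     g \<cdot>\<^bsub>C\<^esub> f = Ident C (Dom C f) \<and> f \<cdot>\<^bsub>C\<^esub> g = Ident C (Cod C f)"

definition iso_arr :: "('o, 'm, 'z) cat_data_scheme \<Rightarrow> 'm \<Rightarrow> bool" where
  "iso_arr C f \<longleftrightarrow> (\<exists>g. inverse_arrows C f g)"

definition inv_arr :: "('o, 'm, 'z) cat_data_scheme \<Rightarrow> 'm \<Rightarrow> 'm" where
  "inv_arr C f = (THE g. inverse_arrows C f g)"

definition prod_cat ::
    "('o1, 'm1, 'y) cat_data_scheme \<Rightarrow> ('o2, 'm2, 'z) cat_data_scheme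
      \<Rightarrow> ('o1 \<times> 'o2, 'm1 \<times> 'm2) cat_data"  (infixr \<open>\<times>\<^sub>C\<close> 80) where
  "A \<times>\<^sub>C B = \<lparr>
     Obj = Obj A \<times> Obj B,
     Arr = Arr A \<times> Arr B,
     Dom = map_prod (Dom A) (Dom B),
     Cod = map_prod (Cod A) (Cod B),
     Ident = map_prod (Ident A) (Ident B),
     Comp = (\<lambda>(g1, g2) (f1, f2). (g1 \<cdot>\<^bsub>A\<^esub> f1, g2 \<cdot>\<^bsub>B\<^esub> f2)) \<rparr>"

record ('o1, 'm1, 'o2, 'm2) functor_data =
  on_obj :: "'o1 \<Rightarrow> 'o2"
  on_arr :: "'m1 \<Rightarrow> 'm2"

definition id_functor :: "('o, 'm, 'o, 'm) functor_data" where
  "id_functor = \<lparr>on_obj = (\<lambda>X. X), on_arr = (\<lambda>f. f)\<rparr>"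

definition comp_functor ::
    "('o2, 'm2, 'o3, 'm3) functor_data \<Rightarrow> ('o1, 'm1, 'o2, 'm2) functor_data
      \<Rightarrow> ('o1, 'm1, 'o3, 'm3) functor_data"  (infixr \<open>\<circ>\<^sub>F\<close> 75) where
  "G \<circ>\<^sub>F F = \<lparr>on_obj = on_obj G \<circ> on_obj F, on_arr = on_arr G \<circ> on_arr F\<rparr>"

definition prod_functor ::
    "('o1, 'm1, 'p1, 'n1) functor_data \<Rightarrow> ('o2, 'm2, 'p2, 'n2) functor_data
      \<Rightarrow> ('o1 \<times> 'o2, 'm1 \<times> 'm2, 'p1 \<times> 'p2, 'n1 \<times> 'n2) functor_data" where
  "prod_functor F G = \<lparr>on_obj = map_prod (on_obj F) (on_obj G), on_arr = map_prod (on_arr F) (on_arr G)\<rparr>"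

locale cat_functor =
  A: category A + B: category B
  for A :: "('o1, 'm1, 'y) cat_data_scheme"
    and B :: "('o2, 'm2, 'z) cat_data_scheme"
    and F :: "('o1, 'm1, 'o2, 'm2) functor_data" +
  assumes on_obj_Obj: "X \<in> Obj A \<Longrightarrow> on_obj F X \<in> Obj B"
    and on_arr_hom: "f \<in> hom A X Y \<Longrightarrow> on_arr F f \<in> hom B (on_obj F X) (on_obj F Y)"
    and on_arr_Id: "X \<in> Obj A \<Longrightarrow> on_arr F (Ident A X) = Ident B (on_obj F X)"
    and on_arr_Comp: "f \<in> hom A X Y \<Longrightarrow> g \<in> hom A Y Z \<Longrightarrow>
      on_arr F (g \<cdot>\<^bsub>A\<^esub> f) = on_arr F g \<cdot>\<^bsub>B\<^esub> on_arr F f"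

locale natural_iso =
  F: cat_functor A B F + G: cat_functor A B G
  for A :: "('o1, 'm1, 'y) cat_data_scheme"
    and B :: "('o2, 'm2, 'z) cat_data_scheme"
    and F G :: "('o1, 'm1, 'o2, 'm2) functor_data" +
  fixes \<tau> :: "'o1 \<Rightarrow> 'm2"
  assumes component_hom: "X \<in> Obj A \<Longrightarrow> \<tau> X \<in> hom B (on_obj F X) (on_obj G X)"
    and component_iso: "X \<in> Obj A \<Longrightarrow> iso_arr B (\<tau> X)"
    and naturality: "f \<in> hom A X Y \<Longrightarrow>
      \<tau> Y \<cdot>\<^bsub>B\<^esub> on_arr F f = on_arr G f \<cdot>\<^bsub>B\<^esub> \<tau> X"


section \<open>Monoidal categories\<close>

record ('o, 'm) monoidal_data = "('o, 'm) cat_data" +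
  tensor :: "('o \<times> 'o, 'm \<times> 'm, 'o, 'm) functor_data"
  unit_obj :: 'o
  assoc :: "'o \<Rightarrow> 'o \<Rightarrow> 'o \<Rightarrow> 'm"
  lunit :: "'o \<Rightarrow> 'm"
  runit :: "'o \<Rightarrow> 'm"

abbreviation tensor_obj :: "('o, 'm, 'z) monoidal_data_scheme \<Rightarrow> 'o \<Rightarrow> 'o \<Rightarrow> 'o"
    (infixr \<open>\<otimes>\<index>\<close> 70) where
  "X \<otimes>\<^bsub>M\<^esub> Y \<equiv> on_obj (tensor M) (X, Y)"

abbreviation tensor_arr :: "('o, 'm, 'z) monoidal_data_scheme \<Rightarrow> 'm \<Rightarrow> 'm \<Rightarrow> 'm"
    (infixr \<open>\<odot>\<index>\<close> 70) where
  "f \<odot>\<^bsub>M\<^esub> g \<equiv> on_arr (tensor M) (f, g)"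

text \<open>
  The functors \<open>((X, Y), Z) \<mapsto> (X \<otimes> Y) \<otimes> Z\<close> and \<open>((X, Y), Z) \<mapsto> X \<otimes> (Y \<otimes> Z)\<close>
  on \<open>(M \<times> M) \<times> M\<close>, and \<open>X \<mapsto> 1 \<otimes> X\<close> and \<open>X \<mapsto> X \<otimes> 1\<close> on \<open>M\<close>.
\<close>

definition tensor3_left ::
    "('o, 'm, 'z) monoidal_data_scheme
      \<Rightarrow> (('o \<times> 'o) \<times> 'o, ('m \<times> 'm) \<times> 'm, 'o, 'm) functor_data" where
  "tensor3_left M =
     \<lparr>on_obj = (\<lambda>((X, Y), Z). (X \<otimes>\<^bsub>M\<^esub> Y) \<otimes>\<^bsub>M\<^esub> Z),
      on_arr = (\<lambda>((f, g), h). (f \<odot>\<^bsub>M\<^esub> g) \<odot>\<^bsub>M\<^esub> h)\<rparr>"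

definition tensor3_right ::
    "('o, 'm, 'z) monoidal_data_scheme
      \<Rightarrow> (('o \<times> 'o) \<times> 'o, ('m \<times> 'm) \<times> 'm, 'o, 'm) functor_data" where
  "tensor3_right M =
     \<lparr>on_obj = (\<lambda>((X, Y), Z). X \<otimes>\<^bsub>M\<^esub> (Y \<otimes>\<^bsub>M\<^esub> Z)),
      on_arr = (\<lambda>((f, g), h). f \<odot>\<^bsub>M\<^esub> (g \<odot>\<^bsub>M\<^esub> h))\<rparr>"

definition unit_tensor ::
    "('o, 'm, 'z) monoidal_data_scheme \<Rightarrow> ('o, 'm, 'o, 'm) functor_data" where
  "unit_tensor M =
     \<lparr>on_obj = (\<lambda>X. unit_obj M \<otimes>\<^bsub>M\<^esub> X),
      on_arr = (\<lambda>f. Ident M (unit_obj M) \<odot>\<^bsub>M\<^esub> f)\<rparr>"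

definition tensor_unit ::
    "('o, 'm, 'z) monoidal_data_scheme \<Rightarrow> ('o, 'm, 'o, 'm) functor_data" where
  "tensor_unit M =
     \<lparr>on_obj = (\<lambda>X. X \<otimes>\<^bsub>M\<^esub> unit_obj M),
      on_arr = (\<lambda>f. f \<odot>\<^bsub>M\<^esub> Ident M (unit_obj M))\<rparr>"

locale monoidal_category =
  category M + tensor_functor: cat_functor "M \<times>\<^sub>C M" M "tensor M"
  for M :: "('o, 'm, 'z) monoidal_data_scheme" (structure) +
  assumes unit_obj_Obj: "unit_obj M \<in> Obj M"
    and assoc_natural:
      "natural_iso ((M \<times>\<^sub>C M) \<times>\<^sub>C M) M (tensor3_left M) (tensor3_right M)
         (\<lambda>((X, Y), Z). assoc M X Y Z)"
    and lunit_natural: "natural_iso M M (unit_tensor M) id_functor (lunit M)"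
    and runit_natural: "natural_iso M M (tensor_unit M) id_functor (runit M)"
    and pentagon:
      "W \<in> Obj M \<Longrightarrow> X \<in> Obj M \<Longrightarrow> Y \<in> Obj M \<Longrightarrow> Z \<in> Obj M \<Longrightarrow>
         (Ident M W \<odot> assoc M X Y Z) \<cdot> assoc M W (X \<otimes> Y) Z \<cdot> (assoc M W X Y \<odot> Ident M Z)
         = assoc M W X (Y \<otimes> Z) \<cdot> assoc M (W \<otimes> X) Y Z"
    and triangle:
      "X \<in> Obj M \<Longrightarrow> Y \<in> Obj M \<Longrightarrow>
         (Ident M X \<odot> lunit M Y) \<cdot> assoc M X (unit_obj M) Y = runit M X \<odot> Ident M Y"

definition prod_monoidal ::
    "('o1, 'm1, 'y) monoidal_data_scheme \<Rightarrow> ('o2, 'm2, 'z) monoidal_data_scheme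
      \<Rightarrow> ('o1 \<times> 'o2, 'm1 \<times> 'm2) monoidal_data"  (infixr \<open>\<times>\<^sub>M\<close> 80) where
  "A \<times>\<^sub>M B = cat_data.extend (A \<times>\<^sub>C B) (monoidal_data.fields
     \<lparr>on_obj = (\<lambda>((X1, Y1), (X2, Y2)). (X1 \<otimes>\<^bsub>A\<^esub> X2, Y1 \<otimes>\<^bsub>B\<^esub> Y2)),
      on_arr = (\<lambda>((f1, g1), (f2, g2)). (f1 \<odot>\<^bsub>A\<^esub> f2, g1 \<odot>\<^bsub>B\<^esub> g2))\<rparr>
     (unit_obj A, unit_obj B)
     (\<lambda>(X1, Y1) (X2, Y2) (X3, Y3). (assoc A X1 X2 X3, assoc B Y1 Y2 Y3))
     (map_prod (lunit A) (lunit B))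
     (map_prod (runit A) (runit B)))"

text \<open>
  Strong monoidal functors, with structure maps \<open>\<mu> X Y : F X \<otimes> F Y \<rightarrow> F (X \<otimes> Y)\<close>
  and \<open>\<eta> : 1 \<rightarrow> F 1\<close>, all invertible.
\<close>

locale strong_monoidal_functor =
  A: monoidal_category A + B: monoidal_category B + cat_functor A B F
  for A :: "('o1, 'm1, 'y) monoidal_data_scheme"
    and B :: "('o2, 'm2, 'z) monoidal_data_scheme"
    and F :: "('o1, 'm1, 'o2, 'm2) functor_data" +
  fixes \<mu> :: "'o1 \<Rightarrow> 'o1 \<Rightarrow> 'm2"
    and \<eta> :: 'm2
  assumes mult_natural:
      "natural_iso (A \<times>\<^sub>C A) B (tensor B \<circ>\<^sub>F prod_functor F F) (F \<circ>\<^sub>F tensor A) (\<lambda>(X, Y). \<mu> X Y)"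
    and unit_hom: "\<eta> \<in> hom B (unit_obj B) (on_obj F (unit_obj A))"
    and unit_iso: "iso_arr B \<eta>"
    and assoc_coherence:
      "X \<in> Obj A \<Longrightarrow> Y \<in> Obj A \<Longrightarrow> Z \<in> Obj A \<Longrightarrow>
         on_arr F (assoc A X Y Z) \<cdot>\<^bsub>B\<^esub> \<mu> (X \<otimes>\<^bsub>A\<^esub> Y) Z \<cdot>\<^bsub>B\<^esub> (\<mu> X Y \<odot>\<^bsub>B\<^esub> Ident B (on_obj F Z))
         = \<mu> X (Y \<otimes>\<^bsub>A\<^esub> Z) \<cdot>\<^bsub>B\<^esub> (Ident B (on_obj F X) \<odot>\<^bsub>B\<^esub> \<mu> Y Z)
           \<cdot>\<^bsub>B\<^esub> assoc B (on_obj F X) (on_obj F Y) (on_obj F Z)"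
    and lunit_coherence:
      "X \<in> Obj A \<Longrightarrow>
         on_arr F (lunit A X) \<cdot>\<^bsub>B\<^esub> \<mu> (unit_obj A) X \<cdot>\<^bsub>B\<^esub> (\<eta> \<odot>\<^bsub>B\<^esub> Ident B (on_obj F X))
         = lunit B (on_obj F X)"
    and runit_coherence:
      "X \<in> Obj A \<Longrightarrow>
         on_arr F (runit A X) \<cdot>\<^bsub>B\<^esub> \<mu> X (unit_obj A) \<cdot>\<^bsub>B\<^esub> (Ident B (on_obj F X) \<odot>\<^bsub>B\<^esub> \<eta>)
         = runit B (on_obj F X)"


section \<open>Braided monoidal categories\<close>

record ('o, 'm) braided_data = "('o, 'm) monoidal_data" +
  braid :: "'o \<Rightarrow> 'o \<Rightarrow> 'm"

definition tensor_op ::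
    "('o, 'm, 'z) monoidal_data_scheme \<Rightarrow> ('o \<times> 'o, 'm \<times> 'm, 'o, 'm) functor_data" where
  "tensor_op M =
     \<lparr>on_obj = (\<lambda>(X, Y). Y \<otimes>\<^bsub>M\<^esub> X), on_arr = (\<lambda>(f, g). g \<odot>\<^bsub>M\<^esub> f)\<rparr>"

locale braided_monoidal_category =
  monoidal_category C
  for C :: "('o, 'm, 'z) braided_data_scheme" (structure) +
  assumes braid_natural:
      "natural_iso (C \<times>\<^sub>C C) C (tensor C) (tensor_op C) (\<lambda>(X, Y). braid C X Y)"
    and hexagon1:
      "X \<in> Obj C \<Longrightarrow> Y \<in> Obj C \<Longrightarrow> Z \<in> Obj C \<Longrightarrow>
         assoc C Y Z X \<cdot> braid C X (Y \<otimes> Z) \<cdot> assoc C X Y Z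
         = (Ident C Y \<odot> braid C X Z) \<cdot> assoc C Y X Z \<cdot> (braid C X Y \<odot> Ident C Z)"
    and hexagon2:
      "X \<in> Obj C \<Longrightarrow> Y \<in> Obj C \<Longrightarrow> Z \<in> Obj C \<Longrightarrow>
         inv_arr C (assoc C Z X Y) \<cdot> braid C (X \<otimes> Y) Z \<cdot> inv_arr C (assoc C X Y Z)
         = (braid C X Z \<odot> Ident C Y) \<cdot> inv_arr C (assoc C X Z Y) \<cdot> (Ident C X \<odot> braid C Y Z)"

text \<open>
  The composite
  \<open>(X1 Y1)(X2 Y2) \<rightarrow> X1(Y1(X2 Y2)) \<rightarrow> X1((Y1 X2)Y2) \<rightarrow> X1((X2 Y1)Y2) \<rightarrow> X1(X2(Y1 Y2)) \<rightarrow> (X1 X2)(Y1 Y2)\<close>.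
  By the pentagon axiom, going through \<open>((X1 Y1)X2)Y2\<close> or \<open>((X1 X2)Y1)Y2\<close> instead gives the
  same map.
\<close>

definition middle_braid ::
    "('o, 'm, 'z) braided_data_scheme \<Rightarrow> 'o \<times> 'o \<Rightarrow> 'o \<times> 'o \<Rightarrow> 'm" where
  "middle_braid C = (\<lambda>(X1, Y1) (X2, Y2).
     inv_arr C (assoc C X1 X2 (Y1 \<otimes>\<^bsub>C\<^esub> Y2))
     \<cdot>\<^bsub>C\<^esub> (Ident C X1 \<odot>\<^bsub>C\<^esub> assoc C X2 Y1 Y2)
     \<cdot>\<^bsub>C\<^esub> (Ident C X1 \<odot>\<^bsub>C\<^esub> (braid C Y1 X2 \<odot>\<^bsub>C\<^esub> Ident C Y2))
     \<cdot>\<^bsub>C\<^esub> (Ident C X1 \<odot>\<^bsub>C\<^esub> inv_arr C (assoc C Y1 X2 Y2))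
     \<cdot>\<^bsub>C\<^esub> assoc C X1 Y1 (X2 \<otimes>\<^bsub>C\<^esub> Y2))"

text \<open>
  The unit constraint \<open>1 \<rightarrow> 1 \<otimes> 1\<close>; using \<open>runit\<close> here gives the same arrow, since the two
  unitors agree at \<open>1\<close> in every monoidal category.
\<close>

definition unit_split :: "('o, 'm, 'z) monoidal_data_scheme \<Rightarrow> 'm" where
  "unit_split M = inv_arr M (lunit M (unit_obj M))"

end

theory Submission
  imports Defs
begin

text \<open>
  Everything is reduced to the map \<open>slide Y X Z : Y \<otimes> (X \<otimes> Z) \<rightarrow> X \<otimes> (Y \<otimes> Z)\<close> that moves \<open>Y\<close> over
  \<open>X\<close> in a right-bracketed product. Up to reassociation the structure map \<open>\<mu>\<close> is \<open>X1 \<otimes> slide Y1 X2 Y2\<close>,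
  and the two hexagons say how \<open>slide\<close> decomposes when \<open>X\<close> or \<open>Y\<close> is a tensor product. After
  rebracketing to the right, both sides of the associativity coherence become products of the same three
  crossings, of \<open>Y2\<close> over \<open>X3\<close>, \<open>Y1\<close> over \<open>X2\<close> and \<open>Y1\<close> over \<open>X3\<close>; only the first two come in a
  different order, and they commute by naturality. The unit coherences follow from Kelly's
  identities for the unitors and the compatibility of the braiding with the unit.
\<close>

section \<open>Categories and monoidal categories\<close>

abbreviation unit_object :: "('o, 'm, 'z) monoidal_data_scheme \<Rightarrow> 'o" (\<open>\<one>\<index>\<close>) where
  "\<one>\<^bsub>M\<^esub> \<equiv> unit_obj M"

lemma hom_iff: "f \<in> hom C X Y \<longleftrightarrow> f \<in> Arr C \<and> Dom C f = X \<and> Cod C f = Y"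
  by (simp add: hom_def)

section \<open>Calculus of composites and isomorphisms in a category\<close>

context category
begin

lemmas Dom_Obj' [simp] = Dom_Obj and Cod_Obj' [simp] = Cod_Obj

lemma Ident_Arr [simp]:
  assumes "X \<in> Obj C"
  shows "Ident C X \<in> Arr C" "Dom C (Ident C X) = X" "Cod C (Ident C X) = X"
  using Id_hom[OF assms] by (simp_all add: hom_iff)

lemma Comp_Arr [simp]:
  assumes "f \<in> Arr C" "g \<in> Arr C" "Dom C g = Cod C f"
  shows "g \<cdot> f \<in> Arr C" "Dom C (g \<cdot> f) = Dom C f" "Cod C (g \<cdot> f) = Cod C g"
  using Comp_hom[of f "Dom C f" "Cod C f" g "Cod C g"] assms by (simp_all add: hom_iff)

lemma Comp_Ident [simp]:
  assumes "f \<in> Arr C"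
  shows "Cod C f = Y \<Longrightarrow> Ident C Y \<cdot> f = f" "Dom C f = X \<Longrightarrow> f \<cdot> Ident C X = f"
  using Comp_Id_left[of f] Comp_Id_right[of f] assms by (auto simp: hom_iff)

lemma Comp_assoc' [simp]:
  assumes "f \<in> Arr C" "g \<in> Arr C" "h \<in> Arr C" "Dom C g = Cod C f" "Dom C h = Cod C g"
  shows "(h \<cdot> g) \<cdot> f = h \<cdot> g \<cdot> f"
  using Comp_assoc[of f "Dom C f" "Cod C f" g "Cod C g" h "Cod C h"] assms by (simp add: hom_iff)

text \<open>The simp rule \<open>Comp_assoc'\<close> nests composites to the right, so an equation
  for \<open>g \<cdot> f\<close> no longer matches inside a longer chain. Applied through
  \<open>THEN\<close>, this rule supplies the variant with a tail \<open>z\<close>.\<close>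

lemma Comp_reduce:
  assumes "g \<cdot> f = k" "f \<in> Arr C" "g \<in> Arr C" "Dom C g = Cod C f" "z \<in> Arr C" "Cod C z = Dom C f"
  shows "g \<cdot> f \<cdot> z = k \<cdot> z"
  using assms Comp_assoc'[of z f g] by simp

text \<open>The same device for threefold left sides such as that of the pentagon.\<close>

lemma Comp_reduce3:
  assumes "g \<cdot> h \<cdot> f = k" "f \<in> Arr C" "g \<in> Arr C" "h \<in> Arr C" "Dom C g = Cod C h" "Dom C h = Cod C f"
    "z \<in> Arr C" "Cod C z = Dom C f"
  shows "g \<cdot> h \<cdot> f \<cdot> z = k \<cdot> z"
  using assms Comp_assoc'[of z f h] Comp_assoc'[of z "h \<cdot> f" g] by simp

lemma inverse_arrows_iff:
  "inverse_arrows C f g \<longleftrightarrow> f \<in> Arr C \<and> g \<in> Arr C \<and> Dom C g = Cod C f \<and> Cod C g = Dom C f \<and>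
     g \<cdot> f = Ident C (Dom C f) \<and> f \<cdot> g = Ident C (Cod C f)"
  by (auto simp: inverse_arrows_def hom_iff)

lemma inverse_arrows_unique:
  assumes "inverse_arrows C f g" "inverse_arrows C f h"
  shows "g = h"
proof -
  have "g = g \<cdot> f \<cdot> h"
    using assms by (simp add: inverse_arrows_iff)
  also have "\<dots> = (g \<cdot> f) \<cdot> h"
    using assms by (subst Comp_assoc') (auto simp: inverse_arrows_iff)
  also have "\<dots> = h"
    using assms by (simp add: inverse_arrows_iff)
  finally show ?thesis .
qed

lemma inverse_arrows_inv_arr:
  assumes "iso_arr C f"
  shows "inverse_arrows C f (inv_arr C f)"
proof -
  obtain g where "inverse_arrows C f g"
    using assms by (auto simp: iso_arr_def)
  then show ?thesis
    unfolding inv_arr_def by (rule theI) (rule inverse_arrows_unique[OF _ \<open>inverse_arrows C f g\<close>])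
qed

lemma inv_arr_simps [simp]:
  assumes "iso_arr C f"
  shows "inv_arr C f \<in> Arr C" "Dom C (inv_arr C f) = Cod C f" "Cod C (inv_arr C f) = Dom C f"
    "inv_arr C f \<cdot> f = Ident C (Dom C f)" "f \<cdot> inv_arr C f = Ident C (Cod C f)"
  using inverse_arrows_inv_arr[OF assms] by (auto simp: inverse_arrows_iff)

lemma iso_arr_Arr: "iso_arr C f \<Longrightarrow> f \<in> Arr C"
  by (auto simp: iso_arr_def inverse_arrows_def)

lemma inv_arr_cancel [simp]:
  assumes "iso_arr C f" "z \<in> Arr C"
  shows "Cod C z = Dom C f \<Longrightarrow> inv_arr C f \<cdot> f \<cdot> z = z"
    "Cod C z = Cod C f \<Longrightarrow> f \<cdot> inv_arr C f \<cdot> z = z"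
  using assms iso_arr_Arr[OF assms(1)] inv_arr_simps(4,5)[OF assms(1), THEN Comp_reduce] by simp_all

lemma iso_arr_Ident [simp]: "X \<in> Obj C \<Longrightarrow> iso_arr C (Ident C X)"
  unfolding iso_arr_def inverse_arrows_iff by (intro exI[of _ "Ident C X"]) simp

lemma iso_arr_inv_arr [simp]: "iso_arr C f \<Longrightarrow> iso_arr C (inv_arr C f)"
  using inverse_arrows_inv_arr[of f] unfolding iso_arr_def[of C "inv_arr C f"] inverse_arrows_iff
  by (intro exI[of _ f]) auto

lemma iso_arr_Comp [simp]:
  assumes "iso_arr C f" "iso_arr C g" "Dom C g = Cod C f"
  shows "iso_arr C (g \<cdot> f)"
  unfolding iso_arr_def inverse_arrows_iff
  using assms iso_arr_Arr[OF assms(1)] iso_arr_Arr[OF assms(2)]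
  by (intro exI[of _ "inv_arr C f \<cdot> inv_arr C g"]) simp

text \<open>Many identities below are checked after precomposing with a suitable associativity
  constraint, which this rule then removes.\<close>

lemma iso_arr_epi:
  assumes "g \<cdot> f = h \<cdot> f" "iso_arr C f" "g \<in> Arr C" "h \<in> Arr C" "Dom C g = Cod C f" "Dom C h = Cod C f"
  shows "g = h"
proof -
  note [simp] = iso_arr_Arr[OF assms(2)]
  have "(g \<cdot> f) \<cdot> inv_arr C f = (h \<cdot> f) \<cdot> inv_arr C f"
    using assms(1) by simp
  then show ?thesis
    using assms(2-) by simp
qed

lemma iso_arr_mono:
  assumes "f \<cdot> g = f \<cdot> h" "iso_arr C f" "g \<in> Arr C" "h \<in> Arr C" "Cod C g = Dom C f" "Cod C h = Dom C f"
  shows "g = h"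
proof -
  have "inv_arr C f \<cdot> f \<cdot> g = inv_arr C f \<cdot> f \<cdot> h"
    using assms(1) by simp
  then show ?thesis
    using assms(2-) by simp
qed

end

section \<open>Functoriality of the tensor product and naturality of associativity\<close>

context monoidal_category
begin

lemma tensor_obj_Obj [simp]: "X \<in> Obj M \<Longrightarrow> Y \<in> Obj M \<Longrightarrow> X \<otimes> Y \<in> Obj M"
  using tensor_functor.on_obj_Obj[of "(X, Y)"] by (simp add: prod_cat_def)

lemma tensor_arr_Arr [simp]:
  assumes "f \<in> Arr M" "g \<in> Arr M"
  shows "f \<odot> g \<in> Arr M" "Dom M (f \<odot> g) = Dom M f \<otimes> Dom M g" "Cod M (f \<odot> g) = Cod M f \<otimes> Cod M g"
  using tensor_functor.on_arr_hom[of "(f, g)" "(Dom M f, Dom M g)" "(Cod M f, Cod M g)"] assms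
  by (simp_all add: prod_cat_def hom_iff)

lemma tensor_Ident [simp]:
  "X \<in> Obj M \<Longrightarrow> Y \<in> Obj M \<Longrightarrow> Ident M X \<odot> Ident M Y = Ident M (X \<otimes> Y)"
  using tensor_functor.on_arr_Id[of "(X, Y)"] by (simp add: prod_cat_def)

lemma tensor_Comp:
  assumes "f \<in> Arr M" "g \<in> Arr M" "Dom M g = Cod M f" "h \<in> Arr M" "k \<in> Arr M" "Dom M k = Cod M h"
  shows "(g \<odot> k) \<cdot> (f \<odot> h) = (g \<cdot> f) \<odot> (k \<cdot> h)"
  using tensor_functor.on_arr_Comp[of "(f, h)" "(Dom M f, Dom M h)" "(Cod M f, Cod M h)"
      "(g, k)" "(Cod M g, Cod M k)"] assms
  by (simp add: prod_cat_def hom_iff)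

text \<open>Oriented against \<open>tensor_Comp\<close>: a whiskered composite is split into a
  chain, on which pentagon and naturality rules can act.\<close>

lemma whisker_Comp:
  assumes "f \<in> Arr M" "g \<in> Arr M" "Dom M g = Cod M f" "X \<in> Obj M"
  shows "Ident M X \<odot> (g \<cdot> f) = (Ident M X \<odot> g) \<cdot> (Ident M X \<odot> f)"
    "(g \<cdot> f) \<odot> Ident M X = (g \<odot> Ident M X) \<cdot> (f \<odot> Ident M X)"
  using assms by (simp_all add: tensor_Comp)

lemma iso_arr_tensor [simp]:
  assumes "iso_arr M f" "iso_arr M g"
  shows "iso_arr M (f \<odot> g)"
  unfolding iso_arr_def inverse_arrows_iff
  using assms iso_arr_Arr[OF assms(1)] iso_arr_Arr[OF assms(2)]
  by (intro exI[of _ "inv_arr M f \<odot> inv_arr M g"]) (simp add: tensor_Comp)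

lemma assoc_Arr [simp]:
  assumes "X \<in> Obj M" "Y \<in> Obj M" "Z \<in> Obj M"
  shows "assoc M X Y Z \<in> Arr M" "Dom M (assoc M X Y Z) = (X \<otimes> Y) \<otimes> Z"
    "Cod M (assoc M X Y Z) = X \<otimes> Y \<otimes> Z" "iso_arr M (assoc M X Y Z)"
  using natural_iso.component_hom[OF assoc_natural, of "((X, Y), Z)"]
    natural_iso.component_iso[OF assoc_natural, of "((X, Y), Z)"] assms
  by (simp_all add: hom_iff prod_cat_def tensor3_left_def tensor3_right_def)

lemma assoc_nat:
  assumes "f \<in> Arr M" "g \<in> Arr M" "h \<in> Arr M"
  shows "assoc M (Cod M f) (Cod M g) (Cod M h) \<cdot> ((f \<odot> g) \<odot> h)
    = (f \<odot> g \<odot> h) \<cdot> assoc M (Dom M f) (Dom M g) (Dom M h)"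
  using natural_iso.naturality[OF assoc_natural, of "((f, g), h)" "((Dom M f, Dom M g), Dom M h)"
      "((Cod M f, Cod M g), Cod M h)"] assms
  by (simp add: hom_iff prod_cat_def tensor3_left_def tensor3_right_def)

text \<open>The object \<open>X\<close> is a variable tied to \<open>Cod M f\<close> by a premise:
  simplification evaluates codomains, so a left side containing \<open>Cod M f\<close> would not
  match. Adjacent identities are already merged, as \<open>tensor_Ident\<close> would do.\<close>

lemma assoc_nat1:
  assumes "f \<in> Arr M" "X = Cod M f" "Y \<in> Obj M" "Z \<in> Obj M"
  shows "assoc M X Y Z \<cdot> ((f \<odot> Ident M Y) \<odot> Ident M Z)
    = (f \<odot> Ident M (Y \<otimes> Z)) \<cdot> assoc M (Dom M f) Y Z"
  using assoc_nat[of f "Ident M Y" "Ident M Z"] assms by simp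

lemma assoc_nat2:
  assumes "f \<in> Arr M" "Y = Cod M f" "X \<in> Obj M" "Z \<in> Obj M"
  shows "assoc M X Y Z \<cdot> ((Ident M X \<odot> f) \<odot> Ident M Z)
    = (Ident M X \<odot> (f \<odot> Ident M Z)) \<cdot> assoc M X (Dom M f) Z"
  using assoc_nat[of "Ident M X" f "Ident M Z"] assms by simp

lemma assoc_nat3:
  assumes "f \<in> Arr M" "Z = Cod M f" "X \<in> Obj M" "Y \<in> Obj M"
  shows "assoc M X Y Z \<cdot> (Ident M (X \<otimes> Y) \<odot> f)
    = (Ident M X \<odot> (Ident M Y \<odot> f)) \<cdot> assoc M X Y (Dom M f)"
  using assoc_nat[of "Ident M X" "Ident M Y" f] assms by simp

lemmas assoc_nats =
  assoc_nat1 assoc_nat1[THEN Comp_reduce]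
  assoc_nat2 assoc_nat2[THEN Comp_reduce]
  assoc_nat3 assoc_nat3[THEN Comp_reduce]

lemmas pentagon' = pentagon pentagon[THEN Comp_reduce3]

section \<open>Unitors and Kelly's identities\<close>

lemma unit_obj_Obj' [simp]: "unit_obj M \<in> Obj M"
  by (rule unit_obj_Obj)

lemma lunit_Arr [simp]:
  assumes "X \<in> Obj M"
  shows "lunit M X \<in> Arr M" "Dom M (lunit M X) = \<one> \<otimes> X" "Cod M (lunit M X) = X"
    "iso_arr M (lunit M X)"
  using natural_iso.component_hom[OF lunit_natural assms]
    natural_iso.component_iso[OF lunit_natural assms]
  by (simp_all add: hom_iff unit_tensor_def id_functor_def)

lemma runit_Arr [simp]:
  assumes "X \<in> Obj M"
  shows "runit M X \<in> Arr M" "Dom M (runit M X) = X \<otimes> \<one>" "Cod M (runit M X) = X"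
    "iso_arr M (runit M X)"
  using natural_iso.component_hom[OF runit_natural assms]
    natural_iso.component_iso[OF runit_natural assms]
  by (simp_all add: hom_iff tensor_unit_def id_functor_def)

lemma lunit_nat:
  assumes "f \<in> Arr M" "X = Cod M f"
  shows "lunit M X \<cdot> (Ident M \<one> \<odot> f) = f \<cdot> lunit M (Dom M f)"
  using natural_iso.naturality[OF lunit_natural, of f "Dom M f" "Cod M f"] assms
  by (simp add: hom_iff unit_tensor_def id_functor_def)

lemma runit_nat:
  assumes "f \<in> Arr M" "X = Cod M f"
  shows "runit M X \<cdot> (f \<odot> Ident M \<one>) = f \<cdot> runit M (Dom M f)"
  using natural_iso.naturality[OF runit_natural, of f "Dom M f" "Cod M f"] assms
  by (simp add: hom_iff tensor_unit_def id_functor_def)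

text \<open>Naturality of the invertible \<open>lunit\<close> recovers \<open>f\<close> from
  \<open>Ident M \<one> \<odot> f\<close>.\<close>

lemma unit_tensor_faithful:
  assumes "Ident M \<one> \<odot> f = Ident M \<one> \<odot> g" "f \<in> Arr M" "g \<in> Arr M"
    "Dom M f = Dom M g" "Cod M f = Cod M g"
  shows "f = g"
proof (rule iso_arr_epi)
  show "f \<cdot> lunit M (Dom M f) = g \<cdot> lunit M (Dom M f)"
    using lunit_nat[of f] lunit_nat[of g] assms by simp
qed (use assms in simp_all)

lemma tensor_unit_faithful:
  assumes "f \<odot> Ident M \<one> = g \<odot> Ident M \<one>" "f \<in> Arr M" "g \<in> Arr M"
    "Dom M f = Dom M g" "Cod M f = Cod M g"
  shows "f = g"
proof (rule iso_arr_epi)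
  show "f \<cdot> runit M (Dom M f) = g \<cdot> runit M (Dom M f)"
    using runit_nat[of f] runit_nat[of g] assms by simp
qed (use assms in simp_all)

text \<open>Kelly's identities: tensoring with the unit is faithful, so each may be checked after doing so.\<close>

lemma lunit_tensor:
  assumes [simp]: "X \<in> Obj M" "Z \<in> Obj M"
  shows "lunit M (X \<otimes> Z) \<cdot> assoc M \<one> X Z = lunit M X \<odot> Ident M Z"
proof (rule unit_tensor_faithful, rule iso_arr_epi)
  \<comment> \<open>The first two arrows on the long side of the pentagon at \<one>, \<one>,
    \<open>X\<close>, \<open>Z\<close>; precomposing with them lets the pentagon act.\<close>
  let ?p = "assoc M \<one> (\<one> \<otimes> X) Z \<cdot> (assoc M \<one> \<one> X \<odot> Ident M Z)"
  have "(Ident M \<one> \<odot> (lunit M (X \<otimes> Z) \<cdot> assoc M \<one> X Z)) \<cdot> ?p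
      = (Ident M \<one> \<odot> lunit M (X \<otimes> Z)) \<cdot> assoc M \<one> \<one> (X \<otimes> Z) \<cdot> assoc M (\<one> \<otimes> \<one>) X Z"
    by (simp add: whisker_Comp pentagon')
  also have "\<dots> = (runit M \<one> \<odot> Ident M (X \<otimes> Z)) \<cdot> assoc M (\<one> \<otimes> \<one>) X Z"
    by (simp add: triangle[THEN Comp_reduce])
  also have "\<dots> = assoc M \<one> X Z \<cdot> ((runit M \<one> \<odot> Ident M X) \<odot> Ident M Z)"
    by (simp add: assoc_nats)
  \<comment> \<open>The triangle is read backwards, now at \<one> and \<open>X\<close> and tensored
    with \<open>Z\<close>.\<close>
  also have "\<dots> = (Ident M \<one> \<odot> (lunit M X \<odot> Ident M Z)) \<cdot> ?p"
    by (simp add: triangle[symmetric] whisker_Comp assoc_nats)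
  finally show "(Ident M \<one> \<odot> (lunit M (X \<otimes> Z) \<cdot> assoc M \<one> X Z)) \<cdot> ?p
      = (Ident M \<one> \<odot> (lunit M X \<odot> Ident M Z)) \<cdot> ?p" .
qed simp_all

lemma runit_tensor:
  assumes [simp]: "X \<in> Obj M" "Y \<in> Obj M"
  shows "(Ident M X \<odot> runit M Y) \<cdot> assoc M X Y \<one> = runit M (X \<otimes> Y)"
proof (rule tensor_unit_faithful, rule iso_arr_mono)
  \<comment> \<open>Postcomposing with the constraint at \<open>X\<close>, \<open>Y\<close>, \<one>
    brings out the pentagon at \<open>X\<close>, \<open>Y\<close>, \<one>, \<one>.\<close>
  have "assoc M X Y \<one> \<cdot> (((Ident M X \<odot> runit M Y) \<cdot> assoc M X Y \<one>) \<odot> Ident M \<one>)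
      = (Ident M X \<odot> (runit M Y \<odot> Ident M \<one>)) \<cdot> assoc M X (Y \<otimes> \<one>) \<one> \<cdot> (assoc M X Y \<one> \<odot> Ident M \<one>)"
    by (simp add: whisker_Comp assoc_nats)
  also have "\<dots> = (Ident M X \<odot> (Ident M Y \<odot> lunit M \<one>)) \<cdot> assoc M X Y (\<one> \<otimes> \<one>) \<cdot> assoc M (X \<otimes> Y) \<one> \<one>"
    by (simp add: triangle[symmetric] whisker_Comp pentagon')
  also have "\<dots> = assoc M X Y \<one> \<cdot> (Ident M (X \<otimes> Y) \<odot> lunit M \<one>) \<cdot> assoc M (X \<otimes> Y) \<one> \<one>"
    by (simp add: assoc_nats)
  also have "\<dots> = assoc M X Y \<one> \<cdot> (runit M (X \<otimes> Y) \<odot> Ident M \<one>)"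
    by (simp add: triangle)
  finally show "assoc M X Y \<one> \<cdot> (((Ident M X \<odot> runit M Y) \<cdot> assoc M X Y \<one>) \<odot> Ident M \<one>)
      = assoc M X Y \<one> \<cdot> (runit M (X \<otimes> Y) \<odot> Ident M \<one>)" .
qed simp_all

end

section \<open>Braidings and the middle interchange\<close>

context braided_monoidal_category
begin

section \<open>Compatibility of the braiding with the unit\<close>

lemma braid_Arr [simp]:
  assumes "X \<in> Obj C" "Y \<in> Obj C"
  shows "braid C X Y \<in> Arr C" "Dom C (braid C X Y) = X \<otimes> Y" "Cod C (braid C X Y) = Y \<otimes> X"
    "iso_arr C (braid C X Y)"
  using natural_iso.component_hom[OF braid_natural, of "(X, Y)"]
    natural_iso.component_iso[OF braid_natural, of "(X, Y)"] assms
  by (simp_all add: hom_iff prod_cat_def tensor_op_def)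

lemma braid_nat:
  assumes "f \<in> Arr C" "g \<in> Arr C" "X = Cod C f" "Y = Cod C g"
  shows "braid C X Y \<cdot> (f \<odot> g) = (g \<odot> f) \<cdot> braid C (Dom C f) (Dom C g)"
  using natural_iso.naturality[OF braid_natural, of "(f, g)" "(Dom C f, Dom C g)"
      "(Cod C f, Cod C g)"] assms
  by (simp add: hom_iff prod_cat_def tensor_op_def)

lemma hexagon2':
  assumes [simp]: "X \<in> Obj C" "Y \<in> Obj C" "Z \<in> Obj C"
  shows "braid C (X \<otimes> Y) Z = assoc C Z X Y \<cdot> (braid C X Z \<odot> Ident C Y) \<cdot> inv_arr C (assoc C X Z Y)
    \<cdot> (Ident C X \<odot> braid C Y Z) \<cdot> assoc C X Y Z"
proof -
  have "braid C (X \<otimes> Y) Z = assoc C Z X Y \<cdot> (inv_arr C (assoc C Z X Y) \<cdot> braid C (X \<otimes> Y) Z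
      \<cdot> inv_arr C (assoc C X Y Z)) \<cdot> assoc C X Y Z"
    by simp
  then show ?thesis
    by (simp add: hexagon2)
qed

text \<open>The second hexagon at two copies of \<one> expresses the braiding of
  \<open>\<one> \<otimes> \<one>\<close> with \<open>X\<close> through two braidings of \<one> with
  \<open>X\<close>. Naturality along \<open>lunit C \<one>\<close> reduces it to a single one, and
  cancelling determines the other.\<close>

lemma runit_braid:
  assumes [simp]: "X \<in> Obj C"
  shows "runit C X \<cdot> braid C \<one> X = lunit C X" (is "?t = _")
proof (rule unit_tensor_faithful, rule iso_arr_epi)
  have inv: "runit C (\<one> \<otimes> X) \<cdot> inv_arr C (assoc C \<one> X \<one>) = Ident C \<one> \<odot> runit C X"
    by (simp add: runit_tensor[symmetric])
  \<comment> \<open>The extra \<open>?t\<close> in front lets naturality of \<open>runit\<close>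
    produce the factor \<open>?t \<odot> Ident C \<one>\<close> that occurs in the hexagon; being
    invertible, it is cancelled afterwards.\<close>
  have "?t \<cdot> (Ident C \<one> \<odot> ?t) \<cdot> assoc C \<one> \<one> X
      = ?t \<cdot> runit C (\<one> \<otimes> X) \<cdot> inv_arr C (assoc C \<one> X \<one>) \<cdot> (Ident C \<one> \<odot> braid C \<one> X) \<cdot> assoc C \<one> \<one> X"
    by (simp add: inv[THEN Comp_reduce] whisker_Comp)
  also have "\<dots> = runit C X \<cdot> (?t \<odot> Ident C \<one>) \<cdot> inv_arr C (assoc C \<one> X \<one>)
      \<cdot> (Ident C \<one> \<odot> braid C \<one> X) \<cdot> assoc C \<one> \<one> X"
    by (simp add: runit_nat[THEN Comp_reduce])
  also have "\<dots> = runit C X \<cdot> (Ident C X \<odot> lunit C \<one>) \<cdot> braid C (\<one> \<otimes> \<one>) X"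
    by (simp add: hexagon2' whisker_Comp triangle[THEN Comp_reduce])
  also have "\<dots> = ?t \<cdot> (lunit C \<one> \<odot> Ident C X)"
    using braid_nat[of "lunit C \<one>" "Ident C X" \<one> X] by simp
  finally have "(Ident C \<one> \<odot> ?t) \<cdot> assoc C \<one> \<one> X = lunit C \<one> \<odot> Ident C X"
    by (rule iso_arr_mono) simp_all
  also have "\<dots> = lunit C (\<one> \<otimes> X) \<cdot> assoc C \<one> \<one> X"
    by (simp add: lunit_tensor)
  \<comment> \<open>This is naturality of \<open>lunit\<close> at the arrow \<open>lunit C X\<close>
    itself, with \<open>lunit C X\<close> cancelled on the left.\<close>
  also have "lunit C (\<one> \<otimes> X) = Ident C \<one> \<odot> lunit C X"
    by (rule iso_arr_mono[where f = "lunit C X"]) (simp_all add: lunit_nat)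
  finally show "(Ident C \<one> \<odot> ?t) \<cdot> assoc C \<one> \<one> X = (Ident C \<one> \<odot> lunit C X) \<cdot> assoc C \<one> \<one> X" .
qed simp_all

text \<open>The mirror argument with the first hexagon; here the invertible factor put in front is
  \<open>braid C X \<one>\<close>.\<close>

lemma lunit_braid:
  assumes [simp]: "X \<in> Obj C"
  shows "lunit C X \<cdot> braid C X \<one> = runit C X" (is "?t = _")
proof (rule tensor_unit_faithful, rule iso_arr_mono)
  have "braid C X \<one> \<cdot> (?t \<odot> Ident C \<one>)
      = braid C X \<one> \<cdot> lunit C (X \<otimes> \<one>) \<cdot> assoc C \<one> X \<one> \<cdot> (braid C X \<one> \<odot> Ident C \<one>)"
    by (simp add: lunit_tensor[THEN Comp_reduce] whisker_Comp)
  also have "\<dots> = lunit C (\<one> \<otimes> X) \<cdot> (Ident C \<one> \<odot> braid C X \<one>) \<cdot> assoc C \<one> X \<one>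
      \<cdot> (braid C X \<one> \<odot> Ident C \<one>)"
    by (simp add: lunit_nat[THEN Comp_reduce])
  also have "\<dots> = lunit C (\<one> \<otimes> X) \<cdot> assoc C \<one> \<one> X \<cdot> braid C X (\<one> \<otimes> \<one>) \<cdot> assoc C X \<one> \<one>"
    by (simp add: hexagon1)
  also have "\<dots> = (lunit C \<one> \<odot> Ident C X) \<cdot> braid C X (\<one> \<otimes> \<one>) \<cdot> assoc C X \<one> \<one>"
    by (simp add: lunit_tensor[THEN Comp_reduce])
  also have "\<dots> = braid C X \<one> \<cdot> (Ident C X \<odot> lunit C \<one>) \<cdot> assoc C X \<one> \<one>"
    by (simp add: braid_nat[THEN Comp_reduce])
  finally show "braid C X \<one> \<cdot> (?t \<odot> Ident C \<one>) = braid C X \<one> \<cdot> (runit C X \<odot> Ident C \<one>)"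
    by (simp add: triangle)
qed simp_all

section \<open>Sliding one factor over another in a right-bracketed product\<close>

definition slide :: "'o \<Rightarrow> 'o \<Rightarrow> 'o \<Rightarrow> 'm" where
  "slide Y X Z = assoc C X Y Z \<cdot> (braid C Y X \<odot> Ident C Z) \<cdot> inv_arr C (assoc C Y X Z)"

lemma slide_Arr [simp]:
  assumes "X \<in> Obj C" "Y \<in> Obj C" "Z \<in> Obj C"
  shows "slide Y X Z \<in> Arr C" "Dom C (slide Y X Z) = Y \<otimes> X \<otimes> Z"
    "Cod C (slide Y X Z) = X \<otimes> Y \<otimes> Z" "iso_arr C (slide Y X Z)"
  using assms by (simp_all add: slide_def)

text \<open>The inverse-free working form of the definition: each identity for \<open>slide\<close>
  below is verified after precomposing with constraints that expose this left side.\<close>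

lemma slide_assoc:
  assumes "X \<in> Obj C" "Y \<in> Obj C" "Z \<in> Obj C"
  shows "slide Y X Z \<cdot> assoc C Y X Z = assoc C X Y Z \<cdot> (braid C Y X \<odot> Ident C Z)"
  using assms by (simp add: slide_def)

lemma slide_nat:
  assumes [simp]: "f \<in> Arr C" "g \<in> Arr C" "h \<in> Arr C"
  shows "slide (Cod C g) (Cod C f) (Cod C h) \<cdot> (g \<odot> f \<odot> h)
    = (f \<odot> g \<odot> h) \<cdot> slide (Dom C g) (Dom C f) (Dom C h)"
proof (rule iso_arr_epi)
  let ?a = "assoc C (Dom C g) (Dom C f) (Dom C h)"
  have "(slide (Cod C g) (Cod C f) (Cod C h) \<cdot> (g \<odot> f \<odot> h)) \<cdot> ?a
      = slide (Cod C g) (Cod C f) (Cod C h) \<cdot> assoc C (Cod C g) (Cod C f) (Cod C h) \<cdot> ((g \<odot> f) \<odot> h)"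
    by (simp add: assoc_nat)
  also have "\<dots> = assoc C (Cod C f) (Cod C g) (Cod C h) \<cdot> ((f \<odot> g) \<odot> h)
      \<cdot> (braid C (Dom C g) (Dom C f) \<odot> Ident C (Dom C h))"
    by (simp add: slide_assoc[THEN Comp_reduce] tensor_Comp braid_nat)
  also have "\<dots> = ((f \<odot> g \<odot> h) \<cdot> slide (Dom C g) (Dom C f) (Dom C h)) \<cdot> ?a"
    by (simp add: assoc_nat[THEN Comp_reduce] slide_assoc)
  finally show "(slide (Cod C g) (Cod C f) (Cod C h) \<cdot> (g \<odot> f \<odot> h)) \<cdot> ?a
    = ((f \<odot> g \<odot> h) \<cdot> slide (Dom C g) (Dom C f) (Dom C h)) \<cdot> ?a" .
qed simp_all

text \<open>A further factor \<open>V\<close> on the right is inert and can be absorbed into the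
  last argument of \<open>slide\<close>; the brackets on both ends are matched by pentagons.\<close>

lemma slide_whisker:
  assumes [simp]: "X \<in> Obj C" "Y \<in> Obj C" "Z \<in> Obj C" "V \<in> Obj C"
  shows "(Ident C X \<odot> assoc C Y Z V) \<cdot> assoc C X (Y \<otimes> Z) V \<cdot> (slide Y X Z \<odot> Ident C V)
    = slide Y X (Z \<otimes> V) \<cdot> (Ident C Y \<odot> assoc C X Z V) \<cdot> assoc C Y (X \<otimes> Z) V" (is "?l = ?r")
proof (rule iso_arr_epi)
  let ?a = "assoc C Y X Z \<odot> Ident C V"
  have "?l \<cdot> ?a = (Ident C X \<odot> assoc C Y Z V) \<cdot> assoc C X (Y \<otimes> Z) V \<cdot> (assoc C X Y Z \<odot> Ident C V)
      \<cdot> ((braid C Y X \<odot> Ident C Z) \<odot> Ident C V)"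
    by (simp add: whisker_Comp(2)[symmetric] slide_assoc)
  also have "\<dots> = assoc C X Y (Z \<otimes> V) \<cdot> (braid C Y X \<odot> Ident C (Z \<otimes> V)) \<cdot> assoc C (Y \<otimes> X) Z V"
    by (simp add: pentagon' assoc_nats)
  also have "\<dots> = ?r \<cdot> ?a"
    by (simp add: pentagon' slide_assoc[THEN Comp_reduce])
  finally show "?l \<cdot> ?a = ?r \<cdot> ?a" .
qed simp_all

text \<open>The first hexagon tensored with \<open>Z\<close>: \<open>V\<close> passes
  \<open>X\<close> and then \<open>Y\<close>.\<close>

lemma slide_hexagon1:
  assumes [simp]: "X \<in> Obj C" "Y \<in> Obj C" "Z \<in> Obj C" "V \<in> Obj C"
  shows "assoc C X Y (V \<otimes> Z) \<cdot> slide V (X \<otimes> Y) Z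
    = (Ident C X \<odot> slide V Y Z) \<cdot> slide V X (Y \<otimes> Z) \<cdot> (Ident C V \<odot> assoc C X Y Z)" (is "?l = ?r")
proof (rule iso_arr_epi)
  let ?a = "assoc C V (X \<otimes> Y) Z \<cdot> (assoc C V X Y \<odot> Ident C Z)"
  have "?l \<cdot> ?a = (assoc C X Y (V \<otimes> Z) \<cdot> assoc C (X \<otimes> Y) V Z)
      \<cdot> (braid C V (X \<otimes> Y) \<odot> Ident C Z) \<cdot> (assoc C V X Y \<odot> Ident C Z)"
    by (simp add: slide_assoc[THEN Comp_reduce])
  \<comment> \<open>The pentagon is expanded from its short side to its long side, against the
    direction of \<open>pentagon'\<close>, to expose the left side of the hexagon.\<close>
  also have "\<dots> = (Ident C X \<odot> assoc C Y V Z) \<cdot> assoc C X (Y \<otimes> V) Z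
      \<cdot> ((assoc C X Y V \<cdot> braid C V (X \<otimes> Y) \<cdot> assoc C V X Y) \<odot> Ident C Z)"
    by (subst pentagon[symmetric]) (simp_all add: whisker_Comp)
  also have "\<dots> = (Ident C X \<odot> (assoc C Y V Z \<cdot> (braid C V Y \<odot> Ident C Z))) \<cdot> assoc C X (V \<otimes> Y) Z
      \<cdot> (assoc C X V Y \<odot> Ident C Z) \<cdot> ((braid C V X \<odot> Ident C Y) \<odot> Ident C Z)"
    by (simp add: hexagon1 whisker_Comp assoc_nats)
  also have "\<dots> = (Ident C X \<odot> slide V Y Z) \<cdot> assoc C X V (Y \<otimes> Z)
      \<cdot> (braid C V X \<odot> Ident C (Y \<otimes> Z)) \<cdot> assoc C (V \<otimes> X) Y Z"
    by (simp add: slide_assoc[symmetric] whisker_Comp pentagon' assoc_nats)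
  also have "\<dots> = ?r \<cdot> ?a"
    by (simp add: pentagon' slide_assoc[THEN Comp_reduce])
  finally show "?l \<cdot> ?a = ?r \<cdot> ?a" .
qed simp_all

text \<open>The second hexagon tensored with \<open>Z\<close>: first \<open>Y\<close> passes
  \<open>V\<close>, then \<open>X\<close> does.\<close>

lemma slide_hexagon2:
  assumes [simp]: "X \<in> Obj C" "Y \<in> Obj C" "Z \<in> Obj C" "V \<in> Obj C"
  shows "(Ident C V \<odot> assoc C X Y Z) \<cdot> slide (X \<otimes> Y) V Z
    = slide X V (Y \<otimes> Z) \<cdot> (Ident C X \<odot> slide Y V Z) \<cdot> assoc C X Y (V \<otimes> Z)" (is "?l = ?r")
proof (rule iso_arr_epi)
  let ?a = "assoc C (X \<otimes> Y) V Z" and ?i = "inv_arr C (assoc C X V Y) \<odot> Ident C Z"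
  \<comment> \<open>The pentagon at \<open>X\<close>, \<open>V\<close>, \<open>Y\<close>,
    \<open>Z\<close> with one leg moved across, to absorb the inverse constraint that
    \<open>hexagon2'\<close> brings in.\<close>
  have inv: "assoc C X V (Y \<otimes> Z) \<cdot> assoc C (X \<otimes> V) Y Z \<cdot> ?i
      = (Ident C X \<odot> assoc C V Y Z) \<cdot> assoc C X (V \<otimes> Y) Z"
    using pentagon[of X V Y Z, symmetric]
    by (subst Comp_assoc'[symmetric]) (simp_all add: whisker_Comp(2)[symmetric])
  have "?l \<cdot> ?a = (Ident C V \<odot> assoc C X Y Z) \<cdot> assoc C V (X \<otimes> Y) Z
      \<cdot> (braid C (X \<otimes> Y) V \<odot> Ident C Z)"
    by (simp add: slide_assoc)
  also have "\<dots> = assoc C V X (Y \<otimes> Z) \<cdot> (braid C X V \<odot> Ident C (Y \<otimes> Z)) \<cdot> assoc C (X \<otimes> V) Y Z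
      \<cdot> ?i \<cdot> ((Ident C X \<odot> braid C Y V) \<odot> Ident C Z) \<cdot> (assoc C X Y V \<odot> Ident C Z)"
    by (simp add: hexagon2' whisker_Comp pentagon' assoc_nats)
  also have "\<dots> = slide X V (Y \<otimes> Z) \<cdot> (Ident C X \<odot> assoc C V Y Z) \<cdot> assoc C X (V \<otimes> Y) Z
      \<cdot> ((Ident C X \<odot> braid C Y V) \<odot> Ident C Z) \<cdot> (assoc C X Y V \<odot> Ident C Z)"
    by (simp add: slide_assoc[symmetric, THEN Comp_reduce] inv[THEN Comp_reduce3])
  also have "\<dots> = slide X V (Y \<otimes> Z) \<cdot> (Ident C X \<odot> (assoc C V Y Z \<cdot> (braid C Y V \<odot> Ident C Z)))
      \<cdot> assoc C X (Y \<otimes> V) Z \<cdot> (assoc C X Y V \<odot> Ident C Z)"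
    by (simp add: whisker_Comp assoc_nats)
  also have "\<dots> = ?r \<cdot> ?a"
    by (simp add: slide_assoc[symmetric] whisker_Comp pentagon')
  finally show "?l \<cdot> ?a = ?r \<cdot> ?a" .
qed simp_all

text \<open>The triangle and \<open>lunit_tensor\<close> reduce this to \<open>runit_braid\<close>
  tensored with \<open>Y\<close>.\<close>

lemma slide_lunit:
  assumes [simp]: "X \<in> Obj C" "Y \<in> Obj C"
  shows "(Ident C X \<odot> lunit C Y) \<cdot> slide \<one> X Y = lunit C (X \<otimes> Y)"
proof (rule iso_arr_epi)
  show "((Ident C X \<odot> lunit C Y) \<cdot> slide \<one> X Y) \<cdot> assoc C \<one> X Y = lunit C (X \<otimes> Y) \<cdot> assoc C \<one> X Y"
    by (simp add: slide_assoc triangle[THEN Comp_reduce] lunit_tensor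
        whisker_Comp(2)[symmetric] runit_braid)
qed simp_all

text \<open>The same reduction, now to \<open>lunit_braid\<close> tensored with
  \<open>Y\<close>.\<close>

lemma lunit_slide:
  assumes [simp]: "X \<in> Obj C" "Y \<in> Obj C"
  shows "lunit C (X \<otimes> Y) \<cdot> slide X \<one> Y = Ident C X \<odot> lunit C Y"
proof (rule iso_arr_epi)
  show "(lunit C (X \<otimes> Y) \<cdot> slide X \<one> Y) \<cdot> assoc C X \<one> Y = (Ident C X \<odot> lunit C Y) \<cdot> assoc C X \<one> Y"
    by (simp add: slide_assoc triangle lunit_tensor[THEN Comp_reduce]
        whisker_Comp(2)[symmetric] lunit_braid)
qed simp_all

section \<open>The middle interchange: naturality and associativity coherence\<close>

abbreviation interchange :: "'o \<Rightarrow> 'o \<Rightarrow> 'o \<Rightarrow> 'o \<Rightarrow> 'm" where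
  "interchange X Y X' Y' \<equiv> middle_braid C (X, Y) (X', Y')"

lemma interchange_eq:
  assumes "X \<in> Obj C" "Y \<in> Obj C" "X' \<in> Obj C" "Y' \<in> Obj C"
  shows "interchange X Y X' Y' = inv_arr C (assoc C X X' (Y \<otimes> Y'))
    \<cdot> (Ident C X \<odot> slide Y X' Y') \<cdot> assoc C X Y (X' \<otimes> Y')"
  using assms by (simp add: middle_braid_def slide_def whisker_Comp)

lemma interchange_Arr [simp]:
  assumes "X \<in> Obj C" "Y \<in> Obj C" "X' \<in> Obj C" "Y' \<in> Obj C"
  shows "interchange X Y X' Y' \<in> Arr C" "Dom C (interchange X Y X' Y') = (X \<otimes> Y) \<otimes> X' \<otimes> Y'"
    "Cod C (interchange X Y X' Y') = (X \<otimes> X') \<otimes> Y \<otimes> Y'" "iso_arr C (interchange X Y X' Y')"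
  using assms by (simp_all add: interchange_eq)

text \<open>The inverse-free working form: rebracketing the target to the right turns the structure
  map into a whiskered \<open>slide\<close>.\<close>

lemma assoc_interchange:
  assumes "X \<in> Obj C" "Y \<in> Obj C" "X' \<in> Obj C" "Y' \<in> Obj C"
  shows "assoc C X X' (Y \<otimes> Y') \<cdot> interchange X Y X' Y'
    = (Ident C X \<odot> slide Y X' Y') \<cdot> assoc C X Y (X' \<otimes> Y')"
  using assms by (simp add: interchange_eq)

lemma interchange_nat:
  assumes [simp]: "f \<in> Arr C" "g \<in> Arr C" "f' \<in> Arr C" "g' \<in> Arr C"
  shows "interchange (Cod C f) (Cod C g) (Cod C f') (Cod C g') \<cdot> ((f \<odot> g) \<odot> (f' \<odot> g'))
    = ((f \<odot> f') \<odot> (g \<odot> g')) \<cdot> interchange (Dom C f) (Dom C g) (Dom C f') (Dom C g')"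
proof (rule iso_arr_mono)
  let ?a = "assoc C (Cod C f) (Cod C f') (Cod C g \<otimes> Cod C g')"
  let ?D = "interchange (Dom C f) (Dom C g) (Dom C f') (Dom C g')"
  have "?a \<cdot> interchange (Cod C f) (Cod C g) (Cod C f') (Cod C g') \<cdot> ((f \<odot> g) \<odot> (f' \<odot> g'))
      = (Ident C (Cod C f) \<odot> slide (Cod C g) (Cod C f') (Cod C g'))
        \<cdot> assoc C (Cod C f) (Cod C g) (Cod C f' \<otimes> Cod C g') \<cdot> ((f \<odot> g) \<odot> (f' \<odot> g'))"
    by (simp add: assoc_interchange[THEN Comp_reduce])
  \<comment> \<open>The third arrow is itself a tensor product whose codomain the simplifier splits,
    so naturality is instantiated by hand.\<close>
  also have "\<dots> = (Ident C (Cod C f) \<odot> slide (Cod C g) (Cod C f') (Cod C g'))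
        \<cdot> (f \<odot> g \<odot> f' \<odot> g') \<cdot> assoc C (Dom C f) (Dom C g) (Dom C f' \<otimes> Dom C g')"
    using assoc_nat[of f g "f' \<odot> g'"] by simp
  also have "\<dots> = (f \<odot> f' \<odot> g \<odot> g') \<cdot> (Ident C (Dom C f) \<odot> slide (Dom C g) (Dom C f') (Dom C g'))
      \<cdot> assoc C (Dom C f) (Dom C g) (Dom C f' \<otimes> Dom C g')"
    by (simp add: tensor_Comp[THEN Comp_reduce] slide_nat)
  also have "\<dots> = (f \<odot> f' \<odot> g \<odot> g') \<cdot> assoc C (Dom C f) (Dom C f') (Dom C g \<otimes> Dom C g') \<cdot> ?D"
    by (simp add: assoc_interchange)
  also have "\<dots> = ?a \<cdot> ((f \<odot> f') \<odot> (g \<odot> g')) \<cdot> ?D"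
    using assoc_nat[of f f' "g \<odot> g'", THEN Comp_reduce] by simp
  finally show "?a \<cdot> interchange (Cod C f) (Cod C g) (Cod C f') (Cod C g') \<cdot> ((f \<odot> g) \<odot> (f' \<odot> g'))
    = ?a \<cdot> ((f \<odot> f') \<odot> (g \<odot> g')) \<cdot> ?D" .
qed simp_all

text \<open>The counterpart of \<open>slide_whisker\<close>: it brings a structure map tensored with
  an inert \<open>V\<close> into right-bracketed form, as the associativity coherence
  requires.\<close>

lemma interchange_whisker:
  assumes [simp]: "X \<in> Obj C" "Y \<in> Obj C" "X' \<in> Obj C" "Y' \<in> Obj C" "V \<in> Obj C"
  shows "assoc C X X' (Y \<otimes> Y' \<otimes> V) \<cdot> (Ident C (X \<otimes> X') \<odot> assoc C Y Y' V)
      \<cdot> assoc C (X \<otimes> X') (Y \<otimes> Y') V \<cdot> (interchange X Y X' Y' \<odot> Ident C V)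
    = (Ident C X \<odot> slide Y X' (Y' \<otimes> V)) \<cdot> assoc C X Y (X' \<otimes> Y' \<otimes> V)
      \<cdot> (Ident C (X \<otimes> Y) \<odot> assoc C X' Y' V) \<cdot> assoc C (X \<otimes> Y) (X' \<otimes> Y') V" (is "?l = ?r")
proof -
  have "?l = (Ident C X \<odot> Ident C X' \<odot> assoc C Y Y' V)
      \<cdot> (assoc C X X' ((Y \<otimes> Y') \<otimes> V) \<cdot> assoc C (X \<otimes> X') (Y \<otimes> Y') V) \<cdot> (interchange X Y X' Y' \<odot> Ident C V)"
    by (simp add: assoc_nats)
  also have "\<dots> = (Ident C X \<odot> Ident C X' \<odot> assoc C Y Y' V)
      \<cdot> (Ident C X \<odot> assoc C X' (Y \<otimes> Y') V) \<cdot> assoc C X (X' \<otimes> Y \<otimes> Y') V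
      \<cdot> ((assoc C X X' (Y \<otimes> Y') \<cdot> interchange X Y X' Y') \<odot> Ident C V)"
    by (subst pentagon[symmetric]) (simp_all add: whisker_Comp)
  also have "\<dots> = (Ident C X \<odot> ((Ident C X' \<odot> assoc C Y Y' V) \<cdot> assoc C X' (Y \<otimes> Y') V
      \<cdot> (slide Y X' Y' \<odot> Ident C V)))
      \<cdot> assoc C X (Y \<otimes> X' \<otimes> Y') V \<cdot> (assoc C X Y (X' \<otimes> Y') \<odot> Ident C V)"
    by (simp add: assoc_interchange whisker_Comp assoc_nats)
  also have "\<dots> = (Ident C X \<odot> slide Y X' (Y' \<otimes> V)) \<cdot> (Ident C X \<odot> Ident C Y \<odot> assoc C X' Y' V)
      \<cdot> assoc C X Y ((X' \<otimes> Y') \<otimes> V) \<cdot> assoc C (X \<otimes> Y) (X' \<otimes> Y') V"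
    by (simp add: slide_whisker whisker_Comp pentagon')
  also have "\<dots> = ?r"
    by (simp add: assoc_nats)
  finally show ?thesis .
qed

lemma interchange_assoc:
  assumes [simp]: "X1 \<in> Obj C" "Y1 \<in> Obj C" "X2 \<in> Obj C" "Y2 \<in> Obj C" "X3 \<in> Obj C" "Y3 \<in> Obj C"
  shows "(assoc C X1 X2 X3 \<odot> assoc C Y1 Y2 Y3) \<cdot> interchange (X1 \<otimes> X2) (Y1 \<otimes> Y2) X3 Y3
      \<cdot> (interchange X1 Y1 X2 Y2 \<odot> Ident C (X3 \<otimes> Y3))
    = interchange X1 Y1 (X2 \<otimes> X3) (Y2 \<otimes> Y3) \<cdot> (Ident C (X1 \<otimes> Y1) \<odot> interchange X2 Y2 X3 Y3)
      \<cdot> assoc C (X1 \<otimes> Y1) (X2 \<otimes> Y2) (X3 \<otimes> Y3)" (is "?l = ?r")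
proof (rule iso_arr_mono)
  \<comment> \<open>\<open>?p\<close> and \<open>?n\<close> rebracket the target and the source to the right.\<close>
  let ?V = "X3 \<otimes> Y3" and ?Y = "Y1 \<otimes> Y2 \<otimes> Y3"
  let ?p = "(Ident C X1 \<odot> assoc C X2 X3 ?Y) \<cdot> assoc C X1 (X2 \<otimes> X3) ?Y"
  let ?n = "assoc C X1 Y1 (X2 \<otimes> Y2 \<otimes> ?V) \<cdot> (Ident C (X1 \<otimes> Y1) \<odot> assoc C X2 Y2 ?V)
    \<cdot> assoc C (X1 \<otimes> Y1) (X2 \<otimes> Y2) ?V"
  \<comment> \<open>The crossings of \<open>Y2\<close> and then \<open>Y1\<close> over
    \<open>X3\<close>, into which \<open>slide_hexagon2\<close> decomposes the passage of
    \<open>Y1 \<otimes> Y2\<close>.\<close>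
  let ?s = "(Ident C X2 \<odot> slide Y1 X3 (Y2 \<otimes> Y3)) \<cdot> (Ident C X2 \<odot> Ident C Y1 \<odot> slide Y2 X3 Y3)"
  let ?\<mu> = "interchange (X1 \<otimes> X2) (Y1 \<otimes> Y2) X3 Y3" and ?\<mu>' = "interchange X1 Y1 X2 Y2 \<odot> Ident C ?V"
  \<comment> \<open>Separating the two constraints lets the pentagon join the first one to
    \<open>?p\<close>, while the second moves on by naturality.\<close>
  have split: "assoc C X1 X2 X3 \<odot> assoc C Y1 Y2 Y3
      = (assoc C X1 X2 X3 \<odot> Ident C ?Y) \<cdot> (Ident C ((X1 \<otimes> X2) \<otimes> X3) \<odot> assoc C Y1 Y2 Y3)"
    by (simp add: tensor_Comp)
  have "?p \<cdot> ?l = assoc C X1 X2 (X3 \<otimes> ?Y) \<cdot> assoc C (X1 \<otimes> X2) X3 ?Y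
      \<cdot> (Ident C ((X1 \<otimes> X2) \<otimes> X3) \<odot> assoc C Y1 Y2 Y3) \<cdot> ?\<mu> \<cdot> ?\<mu>'"
    by (simp add: split pentagon')
  also have "\<dots> = assoc C X1 X2 (X3 \<otimes> ?Y) \<cdot> (Ident C (X1 \<otimes> X2) \<odot> Ident C X3 \<odot> assoc C Y1 Y2 Y3)
      \<cdot> (assoc C (X1 \<otimes> X2) X3 ((Y1 \<otimes> Y2) \<otimes> Y3) \<cdot> ?\<mu>) \<cdot> ?\<mu>'"
    by (simp add: assoc_nats)
  also have "\<dots> = assoc C X1 X2 (X3 \<otimes> ?Y) \<cdot> (Ident C (X1 \<otimes> X2) \<odot>
        ((Ident C X3 \<odot> assoc C Y1 Y2 Y3) \<cdot> slide (Y1 \<otimes> Y2) X3 Y3))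
      \<cdot> assoc C (X1 \<otimes> X2) (Y1 \<otimes> Y2) ?V \<cdot> ?\<mu>'"
    by (simp add: assoc_interchange whisker_Comp)
  also have "\<dots> = (Ident C X1 \<odot> ?s) \<cdot> assoc C X1 X2 (Y1 \<otimes> Y2 \<otimes> ?V)
      \<cdot> (Ident C (X1 \<otimes> X2) \<odot> assoc C Y1 Y2 ?V) \<cdot> assoc C (X1 \<otimes> X2) (Y1 \<otimes> Y2) ?V \<cdot> ?\<mu>'"
    by (simp add: slide_hexagon2 whisker_Comp assoc_nats)
  also have "\<dots> = (Ident C X1 \<odot> ?s) \<cdot> (Ident C X1 \<odot> slide Y1 X2 (Y2 \<otimes> ?V)) \<cdot> ?n"
    by (subst interchange_whisker) simp_all
  also have "\<dots> = (Ident C X1 \<odot> (?s \<cdot> slide Y1 X2 (Y2 \<otimes> ?V))) \<cdot> ?n"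
    by (simp add: whisker_Comp)
  \<comment> \<open>The only exchange of crossings: \<open>Y1\<close> over \<open>X2\<close>
    commutes with \<open>Y2\<close> over \<open>X3\<close> by naturality of \<open>slide\<close> in
    its last argument.\<close>
  also have "?s \<cdot> slide Y1 X2 (Y2 \<otimes> ?V) = (Ident C X2 \<odot> slide Y1 X3 (Y2 \<otimes> Y3))
      \<cdot> slide Y1 X2 (X3 \<otimes> Y2 \<otimes> Y3) \<cdot> (Ident C Y1 \<odot> Ident C X2 \<odot> slide Y2 X3 Y3)"
    using slide_nat[of "Ident C X2" "Ident C Y1" "slide Y2 X3 Y3"] by simp
  also have "(Ident C X1 \<odot> \<dots>) \<cdot> ?n = (Ident C X1 \<odot> ((Ident C X2 \<odot> slide Y1 X3 (Y2 \<otimes> Y3))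
      \<cdot> slide Y1 X2 (X3 \<otimes> Y2 \<otimes> Y3))) \<cdot> assoc C X1 Y1 (X2 \<otimes> X3 \<otimes> Y2 \<otimes> Y3)
      \<cdot> (Ident C (X1 \<otimes> Y1) \<odot> ((Ident C X2 \<odot> slide Y2 X3 Y3) \<cdot> assoc C X2 Y2 ?V))
      \<cdot> assoc C (X1 \<otimes> Y1) (X2 \<otimes> Y2) ?V"
    by (simp add: whisker_Comp assoc_nats)
  also have "\<dots> = (Ident C X1 \<odot> ((Ident C X2 \<odot> slide Y1 X3 (Y2 \<otimes> Y3))
      \<cdot> slide Y1 X2 (X3 \<otimes> Y2 \<otimes> Y3) \<cdot> (Ident C Y1 \<odot> assoc C X2 X3 (Y2 \<otimes> Y3))))
      \<cdot> assoc C X1 Y1 ((X2 \<otimes> X3) \<otimes> Y2 \<otimes> Y3)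
      \<cdot> (Ident C (X1 \<otimes> Y1) \<odot> interchange X2 Y2 X3 Y3) \<cdot> assoc C (X1 \<otimes> Y1) (X2 \<otimes> Y2) ?V"
    by (simp add: assoc_interchange[symmetric] whisker_Comp assoc_nats)
  \<comment> \<open>The passages of \<open>Y1\<close> over \<open>X2\<close> and over
    \<open>X3\<close> are recombined into one over \<open>X2 \<otimes> X3\<close>.\<close>
  also have "\<dots> = ?p \<cdot> ?r"
    by (simp add: slide_hexagon1[symmetric] whisker_Comp assoc_interchange[THEN Comp_reduce])
  finally show "?p \<cdot> ?l = ?p \<cdot> ?r" .
qed simp_all

section \<open>Unit coherence of the middle interchange\<close>

lemma unit_split_simps [simp]:
  "unit_split C \<in> Arr C" "Dom C (unit_split C) = \<one>" "Cod C (unit_split C) = \<one> \<otimes> \<one>"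
  "iso_arr C (unit_split C)" "lunit C \<one> \<cdot> unit_split C = Ident C \<one>"
  by (simp_all add: unit_split_def)

lemma interchange_lunit:
  assumes [simp]: "X \<in> Obj C" "Y \<in> Obj C"
  shows "(lunit C X \<odot> lunit C Y) \<cdot> interchange \<one> \<one> X Y \<cdot> (unit_split C \<odot> Ident C (X \<otimes> Y))
    = lunit C (X \<otimes> Y)"
proof -
  \<comment> \<open>Kelly's identity is used to end this composite in the very constraint on which
    \<open>assoc_interchange\<close> acts.\<close>
  have split: "lunit C X \<odot> lunit C Y
      = (Ident C X \<odot> lunit C Y) \<cdot> lunit C (X \<otimes> \<one> \<otimes> Y) \<cdot> assoc C \<one> X (\<one> \<otimes> Y)"
    by (simp add: lunit_tensor tensor_Comp)
  have "(lunit C X \<odot> lunit C Y) \<cdot> interchange \<one> \<one> X Y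
      = (Ident C X \<odot> lunit C Y) \<cdot> lunit C (X \<otimes> \<one> \<otimes> Y) \<cdot> (Ident C \<one> \<odot> slide \<one> X Y) \<cdot> assoc C \<one> \<one> (X \<otimes> Y)"
    by (simp add: split assoc_interchange)
  also have "\<dots> = lunit C (X \<otimes> Y) \<cdot> lunit C (\<one> \<otimes> X \<otimes> Y) \<cdot> assoc C \<one> \<one> (X \<otimes> Y)"
    by (simp add: lunit_nat[THEN Comp_reduce] slide_lunit[THEN Comp_reduce])
  also have "\<dots> = lunit C (X \<otimes> Y) \<cdot> (lunit C \<one> \<odot> Ident C (X \<otimes> Y))"
    by (simp add: lunit_tensor)
  finally have "(lunit C X \<odot> lunit C Y) \<cdot> interchange \<one> \<one> X Y
      = lunit C (X \<otimes> Y) \<cdot> (lunit C \<one> \<odot> Ident C (X \<otimes> Y))" .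
  \<comment> \<open>Composing with \<open>unit_split C \<odot> Ident C (X \<otimes> Y)\<close>
    cancels the remaining \<open>lunit C \<one>\<close>.\<close>
  from Comp_reduce[OF this] show ?thesis
    by (simp add: whisker_Comp(2)[symmetric])
qed

lemma interchange_runit:
  assumes [simp]: "X \<in> Obj C" "Y \<in> Obj C"
  shows "(runit C X \<odot> runit C Y) \<cdot> interchange X Y \<one> \<one> \<cdot> (Ident C (X \<otimes> Y) \<odot> unit_split C)
    = runit C (X \<otimes> Y)"
proof -
  \<comment> \<open>Here the triangle supplies the constraint for \<open>assoc_interchange\<close>,
    leaving a \<open>lunit\<close> that \<open>lunit_slide\<close> can absorb.\<close>
  have split: "runit C X \<odot> runit C Y
      = (Ident C X \<odot> runit C Y) \<cdot> (Ident C X \<odot> lunit C (Y \<otimes> \<one>)) \<cdot> assoc C X \<one> (Y \<otimes> \<one>)"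
    by (simp add: triangle tensor_Comp)
  have "(runit C X \<odot> runit C Y) \<cdot> interchange X Y \<one> \<one>
      = (Ident C X \<odot> runit C Y) \<cdot> (Ident C X \<odot> (lunit C (Y \<otimes> \<one>) \<cdot> slide Y \<one> \<one>)) \<cdot> assoc C X Y (\<one> \<otimes> \<one>)"
    by (simp add: split assoc_interchange whisker_Comp)
  also have "\<dots> = (Ident C X \<odot> runit C Y) \<cdot> assoc C X Y \<one> \<cdot> (Ident C (X \<otimes> Y) \<odot> lunit C \<one>)"
    by (simp add: lunit_slide assoc_nats)
  also have "\<dots> = runit C (X \<otimes> Y) \<cdot> (Ident C (X \<otimes> Y) \<odot> lunit C \<one>)"
    by (simp add: runit_tensor[THEN Comp_reduce])
  finally have "(runit C X \<odot> runit C Y) \<cdot> interchange X Y \<one> \<one>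
      = runit C (X \<otimes> Y) \<cdot> (Ident C (X \<otimes> Y) \<odot> lunit C \<one>)" .
  from Comp_reduce[OF this] show ?thesis
    by (simp add: whisker_Comp(1)[symmetric])
qed

end

section \<open>Products of monoidal categories\<close>

text \<open>Membership in \<open>hom\<close> is replaced by separate conditions on arrows, domains
  and codomains, which suit simplification on pairs.\<close>

lemma cat_functorI:
  assumes "category A" "category B"
    and "\<And>X. X \<in> Obj A \<Longrightarrow> on_obj F X \<in> Obj B"
    and "\<And>f. f \<in> Arr A \<Longrightarrow> on_arr F f \<in> Arr B"
    and "\<And>f. f \<in> Arr A \<Longrightarrow> Dom B (on_arr F f) = on_obj F (Dom A f)"
    and "\<And>f. f \<in> Arr A \<Longrightarrow> Cod B (on_arr F f) = on_obj F (Cod A f)"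
    and "\<And>X. X \<in> Obj A \<Longrightarrow> on_arr F (Ident A X) = Ident B (on_obj F X)"
    and "\<And>f g. f \<in> Arr A \<Longrightarrow> g \<in> Arr A \<Longrightarrow> Dom A g = Cod A f \<Longrightarrow>
      on_arr F (g \<cdot>\<^bsub>A\<^esub> f) = on_arr F g \<cdot>\<^bsub>B\<^esub> on_arr F f"
  shows "cat_functor A B F"
  using assms by (auto simp: cat_functor_def cat_functor_axioms_def hom_iff)

lemma natural_isoI:
  assumes "cat_functor A B F" "cat_functor A B G"
    and "\<And>X. X \<in> Obj A \<Longrightarrow> \<tau> X \<in> Arr B"
    and "\<And>X. X \<in> Obj A \<Longrightarrow> Dom B (\<tau> X) = on_obj F X"
    and "\<And>X. X \<in> Obj A \<Longrightarrow> Cod B (\<tau> X) = on_obj G X"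
    and "\<And>X. X \<in> Obj A \<Longrightarrow> iso_arr B (\<tau> X)"
    and "\<And>f. f \<in> Arr A \<Longrightarrow> \<tau> (Cod A f) \<cdot>\<^bsub>B\<^esub> on_arr F f = on_arr G f \<cdot>\<^bsub>B\<^esub> \<tau> (Dom A f)"
  shows "natural_iso A B F G \<tau>"
  using assms by (auto simp: natural_iso_def natural_iso_axioms_def hom_iff)

lemma prod_cat_simps [simp]:
  "Obj (A \<times>\<^sub>C B) = Obj A \<times> Obj B"
  "Arr (A \<times>\<^sub>C B) = Arr A \<times> Arr B"
  "Dom (A \<times>\<^sub>C B) = map_prod (Dom A) (Dom B)"
  "Cod (A \<times>\<^sub>C B) = map_prod (Cod A) (Cod B)"
  "Ident (A \<times>\<^sub>C B) = map_prod (Ident A) (Ident B)"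
  "(g1, g2) \<cdot>\<^bsub>A \<times>\<^sub>C B\<^esub> (f1, f2) = (g1 \<cdot>\<^bsub>A\<^esub> f1, g2 \<cdot>\<^bsub>B\<^esub> f2)"
  by (simp_all add: prod_cat_def)

lemma prod_monoidal_simps [simp]:
  "Obj (A \<times>\<^sub>M B) = Obj A \<times> Obj B"
  "Arr (A \<times>\<^sub>M B) = Arr A \<times> Arr B"
  "Dom (A \<times>\<^sub>M B) = map_prod (Dom A) (Dom B)"
  "Cod (A \<times>\<^sub>M B) = map_prod (Cod A) (Cod B)"
  "Ident (A \<times>\<^sub>M B) = map_prod (Ident A) (Ident B)"
  "(f2, g2) \<cdot>\<^bsub>A \<times>\<^sub>M B\<^esub> (f1, g1) = (f2 \<cdot>\<^bsub>A\<^esub> f1, g2 \<cdot>\<^bsub>B\<^esub> g1)"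
  "(X1, Y1) \<otimes>\<^bsub>A \<times>\<^sub>M B\<^esub> (X2, Y2) = (X1 \<otimes>\<^bsub>A\<^esub> X2, Y1 \<otimes>\<^bsub>B\<^esub> Y2)"
  "(f1, g1) \<odot>\<^bsub>A \<times>\<^sub>M B\<^esub> (f2, g2) = (f1 \<odot>\<^bsub>A\<^esub> f2, g1 \<odot>\<^bsub>B\<^esub> g2)"
  "unit_obj (A \<times>\<^sub>M B) = (unit_obj A, unit_obj B)"
  "assoc (A \<times>\<^sub>M B) (X1, Y1) (X2, Y2) (X3, Y3) = (assoc A X1 X2 X3, assoc B Y1 Y2 Y3)"
  "lunit (A \<times>\<^sub>M B) = map_prod (lunit A) (lunit B)"
  "runit (A \<times>\<^sub>M B) = map_prod (runit A) (runit B)"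
  by (simp_all add: prod_monoidal_def cat_data.defs monoidal_data.defs prod_cat_def)

lemma category_prod_cat:
  assumes "category A" "category B"
  shows "category (A \<times>\<^sub>C B)"
proof -
  interpret A: category A by fact
  interpret B: category B by fact
  show ?thesis
    by unfold_locales (auto simp: hom_iff)
qed

text \<open>\<open>A \<times>\<^sub>M B\<close> has a different record type from
  \<open>A \<times>\<^sub>C B\<close>, so the category axioms are verified for it
  separately.\<close>

lemma category_prod_monoidal:
  assumes "category A" "category B"
  shows "category (A \<times>\<^sub>M B)"
proof -
  interpret A: category A by fact
  interpret B: category B by fact
  show ?thesis
    by unfold_locales (auto simp: hom_iff)
qed

lemma cat_functor_id:
  assumes "category A"
  shows "cat_functor A A id_functor"
  using assms by (intro cat_functorI) (simp_all add: id_functor_def)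

lemma iso_arr_prod_monoidal:
  assumes "iso_arr A f" "iso_arr B g"
  shows "iso_arr (A \<times>\<^sub>M B) (f, g)"
proof -
  obtain f' g' where "inverse_arrows A f f'" "inverse_arrows B g g'"
    using assms by (auto simp: iso_arr_def)
  then show ?thesis
    unfolding iso_arr_def inverse_arrows_def by (intro exI[of _ "(f', g')"]) (simp add: hom_iff)
qed

lemma monoidal_category_prod:
  assumes "monoidal_category A" "monoidal_category B"
  shows "monoidal_category (A \<times>\<^sub>M B)"
proof -
  interpret A: monoidal_category A by fact
  interpret B: monoidal_category B by fact
  let ?P = "A \<times>\<^sub>M B"
  note cats = category_prod_cat category_prod_monoidal A.category_axioms B.category_axioms
  note simps = A.tensor_Comp B.tensor_Comp A.assoc_nat B.assoc_nat A.lunit_nat B.lunit_nat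
    A.runit_nat B.runit_nat iso_arr_prod_monoidal
    tensor3_left_def tensor3_right_def unit_tensor_def tensor_unit_def
  have tensor: "cat_functor (?P \<times>\<^sub>C ?P) ?P (tensor ?P)"
    by (intro cat_functorI cats) (auto simp: simps)
  have left: "cat_functor ((?P \<times>\<^sub>C ?P) \<times>\<^sub>C ?P) ?P (tensor3_left ?P)"
    by (intro cat_functorI cats) (auto simp: simps)
  have right: "cat_functor ((?P \<times>\<^sub>C ?P) \<times>\<^sub>C ?P) ?P (tensor3_right ?P)"
    by (intro cat_functorI cats) (auto simp: simps)
  have lunit: "cat_functor ?P ?P (unit_tensor ?P)"
    by (intro cat_functorI cats) (auto simp: simps)
  have runit: "cat_functor ?P ?P (tensor_unit ?P)"
    by (intro cat_functorI cats) (auto simp: simps)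
  have id: "cat_functor ?P ?P id_functor"
    by (intro cat_functor_id cats)
  show ?thesis
  proof (intro monoidal_category.intro monoidal_category_axioms.intro cats tensor)
    show "natural_iso ((?P \<times>\<^sub>C ?P) \<times>\<^sub>C ?P) ?P (tensor3_left ?P) (tensor3_right ?P)
        (\<lambda>((X, Y), Z). assoc ?P X Y Z)"
      by (intro natural_isoI left right) (auto simp: simps)
    show "natural_iso ?P ?P (unit_tensor ?P) id_functor (lunit ?P)"
      by (intro natural_isoI lunit id) (auto simp: simps id_functor_def)
    show "natural_iso ?P ?P (tensor_unit ?P) id_functor (runit ?P)"
      by (intro natural_isoI runit id) (auto simp: simps id_functor_def)
  qed (auto simp: A.pentagon B.pentagon A.triangle B.triangle)
qed

theorem theorem1:
  fixes C :: "('o, 'm, 'z) braided_data_scheme"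
  assumes "braided_monoidal_category C"
  shows "strong_monoidal_functor (C \<times>\<^sub>M C) C (tensor C) (middle_braid C) (unit_split C)"
proof -
  interpret braided_monoidal_category C by fact
  let ?P = "C \<times>\<^sub>M C"
  note cats = category_prod_cat category_prod_monoidal category_axioms
  note defs = comp_functor_def prod_functor_def
  \<comment> \<open>The locale gives functoriality on \<open>C \<times>\<^sub>C C\<close>; the
    source required here is the monoidal product \<open>?P\<close>.\<close>
  have tensor: "cat_functor ?P C (tensor C)"
    by (intro cat_functorI cats) (auto simp: tensor_Comp)
  have source: "cat_functor (?P \<times>\<^sub>C ?P) C (tensor C \<circ>\<^sub>F prod_functor (tensor C) (tensor C))"
    by (intro cat_functorI cats) (auto simp: defs tensor_Comp)
  have target: "cat_functor (?P \<times>\<^sub>C ?P) C (tensor C \<circ>\<^sub>F tensor ?P)"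
    by (intro cat_functorI cats) (auto simp: defs tensor_Comp)
  show ?thesis
  proof (intro strong_monoidal_functor.intro strong_monoidal_functor_axioms.intro
      monoidal_category_prod monoidal_category_axioms tensor)
    show "natural_iso (?P \<times>\<^sub>C ?P) C (tensor C \<circ>\<^sub>F prod_functor (tensor C) (tensor C))
        (tensor C \<circ>\<^sub>F tensor ?P) (\<lambda>(X, Y). middle_braid C X Y)"
      by (intro natural_isoI source target) (auto simp: defs interchange_nat)
  \<comment> \<open>On pairs of objects, the three coherence conditions become the corresponding
    \<open>interchange\<close> identities.\<close>
  qed (auto simp: hom_iff interchange_assoc interchange_lunit interchange_runit)
qed

end
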